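(* There exist $n\ge1$, a bounded open set $\Omega\subset\mathbb{R}^n$ with $C^{1,\gamma}$-boundary (for some $\gamma\in(0,1)$), and a measurable set $E\subseteq\mathbb{R}^n$ for which $\mathrm{Per}_s(E;\Omega)=+\infty$ for any $s\in(0,1)$.
   Context: For $s\in(0,1)$ and measurable $A,B\subseteq\mathbb{R}^n$, set $L(A,B):=\int_A\int_B\frac{1}{|x-y|^{n+s}}\,dx\,dy\in[0,+\infty]$ (with $L(A,B)=0$ if $A$ or $B$ is empty). Write $\mathcal{C}E=\mathbb{R}^n\setminus E$. The $s$-perimeter of a measurable set $E\subseteq\mathbb{R}^n$ in $\Omega$ is $$\mathrm{Per}_s(E;\Omega):=L(E\cap\Omega,(\mathcal{C}E)\cap\Omega)+L(E\cap\Omega,(\mathcal{C}E)\cap(\mathcal{C}\Omega))+L(E\cap(\mathcal{C}\Omega),(\mathcal{C}E)\cap\Omega).$$ For $n=1$, a bounded open interval counts as a bounded open set with $C^{1,\gamma}$-boundary. *)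

theory Defs
  imports "HOL-Analysis.Analysis"
begin

text \<open>The dimension is existentially quantified in the statement, so it cannot be a type.
  We represent \<open>\<real>\<^sup>n\<close> by the extensional functions on \<open>{..<n}\<close>, which are at once the
  points of the library's finite product topology and finite product measure.\<close>

definition eucl_top :: "nat \<Rightarrow> (nat \<Rightarrow> real) topology" where
  "eucl_top n = product_topology (\<lambda>_. euclideanreal) {..<n}"

abbreviation eucl :: "nat \<Rightarrow> (nat \<Rightarrow> real) set" where
  "eucl n \<equiv> {..<n} \<rightarrow>\<^sub>E UNIV"

definition eucl_dist :: "nat \<Rightarrow> (nat \<Rightarrow> real) \<Rightarrow> (nat \<Rightarrow> real) \<Rightarrow> real" where
  "eucl_dist n x y = L2_set (\<lambda>i. x i - y i) {..<n}"

definition eucl_lebesgue :: "nat \<Rightarrow> (nat \<Rightarrow> real) measure" where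
  "eucl_lebesgue n = completion (Pi\<^sub>M {..<n} (\<lambda>_. lborel))"

definition eucl_bounded :: "nat \<Rightarrow> (nat \<Rightarrow> real) set \<Rightarrow> bool" where
  "eucl_bounded n S \<longleftrightarrow> S \<subseteq> eucl n \<and> (\<exists>K. \<forall>x\<in>S. L2_set x {..<n} \<le> K)"

definition eucl_isometry :: "nat \<Rightarrow> ((nat \<Rightarrow> real) \<Rightarrow> (nat \<Rightarrow> real)) \<Rightarrow> bool" where
  "eucl_isometry n T \<longleftrightarrow> bij_betw T (eucl n) (eucl n) \<and>
     (\<forall>x\<in>eucl n. \<forall>y\<in>eucl n. eucl_dist n (T x) (T y) = eucl_dist n x y)"

text \<open>Existence and Hoelder continuity of all first partial derivatives; the latter makes
  them continuous, so the function is continuously differentiable.\<close>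

definition C1_holder :: "nat \<Rightarrow> real \<Rightarrow> ((nat \<Rightarrow> real) \<Rightarrow> real) \<Rightarrow> bool" where
  "C1_holder m \<gamma> \<phi> \<longleftrightarrow> (\<exists>g C.
     (\<forall>x\<in>eucl m. \<forall>i<m. ((\<lambda>t. \<phi> (x(i := t))) has_real_derivative g i x) (at (x i))) \<and>
     (\<forall>x\<in>eucl m. \<forall>y\<in>eucl m. \<forall>i<m. \<bar>g i x - g i y\<bar> \<le> C * eucl_dist m x y powr \<gamma>))"

text \<open>Near each boundary point and in suitable Cartesian coordinates (the rigid motion \<open>T\<close>),
  the set is the strict supergraph of a \<open>C\<^sup>1\<^sup>,\<^sup>\<gamma>\<close> function of the first \<open>n - 1\<close> coordinates.
  For \<open>n = 1\<close> that function is a constant.\<close>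

definition C1_holder_boundary :: "nat \<Rightarrow> real \<Rightarrow> (nat \<Rightarrow> real) set \<Rightarrow> bool" where
  "C1_holder_boundary n \<gamma> \<Omega> \<longleftrightarrow> (\<forall>p \<in> eucl_top n frontier_of \<Omega>.
     \<exists>r>0. \<exists>T \<phi>. eucl_isometry n T \<and> C1_holder (n - 1) \<gamma> \<phi> \<and>
       (\<forall>x\<in>eucl n. eucl_dist n x p < r \<longrightarrow>
          (x \<in> \<Omega> \<longleftrightarrow> \<phi> (restrict (T x) {..<n - 1}) < T x (n - 1))))"

lemma C1_holder_boundary_interval:
  assumes "a < b"
  shows "C1_holder_boundary 1 \<gamma> {x \<in> eucl 1. a < x 0 \<and> x 0 < b}"
proof -
  let ?I = "{x \<in> eucl 1. a < x 0 \<and> x 0 < b}"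
  have sp: "topspace (eucl_top n) = eucl n" for n
    by (simp add: eucl_top_def)
  have cont: "continuous_map (eucl_top 1) euclideanreal (\<lambda>x. x 0)"
    unfolding eucl_top_def by (rule continuous_map_product_projection) simp
  have "openin (eucl_top 1) {x \<in> topspace (eucl_top 1). x 0 \<in> {a<..<b}}"
    using cont by (rule openin_continuous_map_preimage) simp
  then have op: "openin (eucl_top 1) ?I"
    by (simp add: sp)
  have "closedin (eucl_top 1) {x \<in> topspace (eucl_top 1). x 0 \<in> {a..b}}"
    using cont by (rule closedin_continuous_map_preimage) simp
  then have cl: "closedin (eucl_top 1) {x \<in> eucl 1. x 0 \<in> {a..b}}"
    by (simp add: sp)
  have fr: "p 0 = a \<or> p 0 = b" if p: "p \<in> eucl_top 1 frontier_of ?I" for p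
  proof -
    have sub: "?I \<subseteq> {x \<in> eucl 1. x 0 \<in> {a..b}}"
      by (rule Collect_mono) (simp only: atLeastAtMost_iff, meson less_imp_le)
    have cp: "p \<in> eucl_top 1 closure_of ?I" and notin: "p \<notin> ?I"
      using p by (simp_all only: frontier_of_def interior_of_openin[OF op] Diff_iff simp_thms)
    have "p \<in> {x \<in> eucl 1. x 0 \<in> {a..b}}"
      by (rule subsetD[OF closure_of_minimal[OF sub cl] cp])
    with notin show ?thesis
      by (simp only: mem_Collect_eq atLeastAtMost_iff) (metis order_le_less)
  qed
  have dist1: "eucl_dist 1 x y = \<bar>x 0 - y 0\<bar>" for x y
    by (simp add: eucl_dist_def L2_set_def)
  have C1: "C1_holder (1 - 1) \<gamma> (\<lambda>_. c)" for c
    by (simp add: C1_holder_def)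
  have iso_id: "eucl_isometry 1 (\<lambda>x. x)"
    by (simp add: eucl_isometry_def bij_betw_def)
  have "bij_betw (\<lambda>x. \<lambda>i\<in>{..<1::nat}. - x i :: real) (eucl 1) (eucl 1)"
    by (rule bij_betw_byWitness[where f' = "\<lambda>x. \<lambda>i\<in>{..<1::nat}. - x i"])
       (auto simp: fun_eq_iff restrict_def PiE_def extensional_def)
  then have iso_neg: "eucl_isometry 1 (\<lambda>x. \<lambda>i\<in>{..<1}. - x i)"
    unfolding eucl_isometry_def dist1 by (simp only: lessThan_iff restrict_apply)
      (simp add: abs_minus_commute)
  show ?thesis
    unfolding C1_holder_boundary_def
  proof
    fix p assume "p \<in> eucl_top 1 frontier_of ?I"
    from fr[OF this] show "\<exists>r>0. \<exists>T \<phi>. eucl_isometry 1 T \<and> C1_holder (1 - 1) \<gamma> \<phi> \<and>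
       (\<forall>x\<in>eucl 1. eucl_dist 1 x p < r \<longrightarrow>
          (x \<in> ?I \<longleftrightarrow> \<phi> (restrict (T x) {..<1 - 1}) < T x (1 - 1)))"
    proof
      assume p: "p 0 = a"
      have "\<forall>x\<in>eucl 1. eucl_dist 1 x p < b - a \<longrightarrow> (x \<in> ?I \<longleftrightarrow> a < x (1 - 1))"
        using p by (simp only: dist1 mem_Collect_eq diff_self_eq_0) force
      moreover have "0 < b - a" using assms by simp
      ultimately show ?thesis
        using iso_id C1[of a] by blast
    next
      assume p: "p 0 = b"
      have "\<forall>x\<in>eucl 1. eucl_dist 1 x p < b - a \<longrightarrow>
          (x \<in> ?I \<longleftrightarrow> - b < (\<lambda>i\<in>{..<1}. - x i) (1 - 1))"
        using p by (simp only: dist1 mem_Collect_eq diff_self_eq_0 restrict_apply) force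
      moreover have "0 < b - a" using assms by simp
      ultimately show ?thesis
        using iso_neg C1[of "- b"] by blast
    qed
  qed
qed

definition interaction :: "nat \<Rightarrow> real \<Rightarrow> (nat \<Rightarrow> real) set \<Rightarrow> (nat \<Rightarrow> real) set \<Rightarrow> ennreal" where
  "interaction n s A B =
     (\<integral>\<^sup>+x\<in>A. (\<integral>\<^sup>+y\<in>B. 1 / ennreal (eucl_dist n x y powr (real n + s)) \<partial>eucl_lebesgue n)
       \<partial>eucl_lebesgue n)"

definition s_perimeter :: "nat \<Rightarrow> real \<Rightarrow> (nat \<Rightarrow> real) set \<Rightarrow> (nat \<Rightarrow> real) set \<Rightarrow> ennreal" where
  "s_perimeter n s E \<Omega> =
     interaction n s (E \<inter> \<Omega>) ((eucl n - E) \<inter> \<Omega>) +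
     interaction n s (E \<inter> \<Omega>) ((eucl n - E) \<inter> (eucl n - \<Omega>)) +
     interaction n s (E \<inter> (eucl n - \<Omega>)) ((eucl n - E) \<inter> \<Omega>)"

end

theory Submission
  imports Defs "HOL-Real_Asymp.Real_Asymp"
begin

text \<open>
  Take \<open>n = 1\<close> and \<open>\<Omega> = (0, 1)\<close>, cut \<open>\<Omega>\<close> into the dyadic shells \<open>[2\<^sup>-\<^sup>m\<^sup>-\<^sup>1, 2\<^sup>-\<^sup>m)\<close>, and let \<open>E\<close>
  consist of every other cell when the \<open>m\<close>-th shell is cut into cells of length
  \<open>h = 2 powr -(m\<^sup>2 + m + 2)\<close>. A point of \<open>E\<close> in the \<open>m\<close>-th shell has a whole cell of the complement
  within distance \<open>2 h\<close>, which contributes at least \<open>h (2 h) powr -(1 + s)\<close> to the inner integral.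
  Half of the shell lies in \<open>E\<close>, so the interaction is at least of the order of
  \<open>2 powr (s m\<^sup>2 - m)\<close>, which is unbounded in \<open>m\<close> for every \<open>s > 0\<close>.
\<close>

section \<open>Subsets of the real line as subsets of \<open>eucl 1\<close>\<close>

definition lift1 :: "real set \<Rightarrow> (nat \<Rightarrow> real) set" where
  "lift1 S = ({..<1} \<rightarrow>\<^sub>E S)"

text \<open>The pointwise form of \<open>lift1\<close>; its definition as a box is the shape to
  which \<open>emeasure_PiM\<close> applies.\<close>

lemma lift1_eq: "lift1 S = {x \<in> eucl 1. x 0 \<in> S}"
proof -
  have "x \<in> lift1 S \<longleftrightarrow> x \<in> eucl 1 \<and> x 0 \<in> S" for x
    unfolding lift1_def PiE_iff Ball_def lessThan_iff less_one by blast
  then show ?thesis by blast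
qed

lemma
  assumes "S \<in> sets borel"
  shows lift1_sets: "lift1 S \<in> sets (eucl_lebesgue 1)"
    and emeasure_lift1: "emeasure (eucl_lebesgue 1) (lift1 S) = emeasure lborel S"
proof -
  interpret product_sigma_finite "\<lambda>_::nat. lborel :: real measure"
    by (simp add: product_sigma_finite_def lborel.sigma_finite_measure_axioms)
  let ?P = "Pi\<^sub>M {..<1::nat} (\<lambda>_. lborel :: real measure)"
  have P: "lift1 S \<in> sets ?P"
    unfolding lift1_def by (rule sets_PiM_I_finite) (use assms in simp_all)
  then show "lift1 S \<in> sets (eucl_lebesgue 1)"
    unfolding eucl_lebesgue_def by (rule sets_completionI_sets)
  have "emeasure (eucl_lebesgue 1) (lift1 S) = emeasure ?P (lift1 S)"
    unfolding eucl_lebesgue_def using P by simp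
  also have "\<dots> = (\<Prod>i\<in>{..<1::nat}. emeasure lborel S)"
    unfolding lift1_def by (rule emeasure_PiM) (use assms in simp_all)
  finally show "emeasure (eucl_lebesgue 1) (lift1 S) = emeasure lborel S"
    by simp
qed

section \<open>A lower bound for the interaction of two sets\<close>

lemma const_times_emeasure_le_nn_integral:
  assumes "A \<in> sets M" "A \<subseteq> B" "\<And>x. x \<in> A \<Longrightarrow> c \<le> f x"
  shows "c * emeasure M A \<le> (\<integral>\<^sup>+x\<in>B. f x \<partial>M)"
proof -
  have "c * emeasure M A = (\<integral>\<^sup>+x. c * indicator A x \<partial>M)"
    using assms(1) by (simp add: nn_integral_cmult_indicator)
  also have "\<dots> \<le> (\<integral>\<^sup>+x\<in>B. f x \<partial>M)"
    using assms(2,3) by (intro nn_integral_mono) (auto simp: indicator_def)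
  finally show ?thesis .
qed

text \<open>Two nested constant bounds: for each \<open>x\<close> the kernel is at least
  \<open>(2 * h) powr (- (1 + s))\<close> on a set \<open>B\<close> of measure \<open>h\<close>, and
  the resulting bound on the inner integral is the same for all \<open>x\<close> in
  \<open>A\<close>. The set \<open>B\<close> may depend on \<open>x\<close>. The condition
  \<open>x \<notin> B\<close> keeps the distance positive, which matters since
  \<open>0 powr a = 0\<close>.\<close>

lemma interaction_ge:
  assumes A: "A \<in> sets borel" "lift1 A \<subseteq> X"
    and near: "\<And>x. x \<in> A \<Longrightarrow> \<exists>B\<in>sets borel. lift1 B \<subseteq> Y \<and> x \<notin> B
        \<and> emeasure lborel B = ennreal h \<and> (\<forall>y\<in>B. \<bar>x - y\<bar> \<le> 2 * h)"
    and "0 < h" "0 < s"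
  shows "ennreal ((2 * h) powr (- s) / 2) * emeasure lborel A \<le> interaction 1 s X Y"
proof -
  have "ennreal ((2 * h) powr (- s) / 2) * emeasure (eucl_lebesgue 1) (lift1 A)
      \<le> interaction 1 s X Y"
    unfolding interaction_def
  proof (rule const_times_emeasure_le_nn_integral)
    show "lift1 A \<in> sets (eucl_lebesgue 1)" "lift1 A \<subseteq> X"
      using A lift1_sets by blast+
    fix x assume "x \<in> lift1 A"
    then have "x 0 \<in> A" by (simp add: lift1_eq)
    from near[OF this] obtain B where B: "B \<in> sets borel" "lift1 B \<subseteq> Y" "x 0 \<notin> B"
      "emeasure lborel B = ennreal h" "\<forall>y\<in>B. \<bar>x 0 - y\<bar> \<le> 2 * h"
      by blast
    \<comment> \<open>The smallest kernel value on \<open>B\<close> times the measure of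
      \<open>B\<close>.\<close>
    have "(2 * h) powr (- s) / 2 = (2 * h) powr (- (1 + s)) * h"
      using \<open>0 < h\<close> powr_add[of "2 * h" "- (1 + s)" 1] by (simp add: field_simps)
    then have "ennreal ((2 * h) powr (- s) / 2)
        = ennreal ((2 * h) powr (- (1 + s))) * emeasure (eucl_lebesgue 1) (lift1 B)"
      using B(4) \<open>0 < h\<close> unfolding emeasure_lift1[OF B(1)] by (simp add: ennreal_mult)
    also have "\<dots> \<le> (\<integral>\<^sup>+y\<in>Y. 1 / ennreal (eucl_dist 1 x y powr (real 1 + s)) \<partial>eucl_lebesgue 1)"
    proof (rule const_times_emeasure_le_nn_integral)
      show "lift1 B \<in> sets (eucl_lebesgue 1)" "lift1 B \<subseteq> Y"
        using B lift1_sets by blast+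
      fix y assume "y \<in> lift1 B"
      then have y: "y 0 \<in> B" by (simp add: lift1_eq)
      have d: "eucl_dist 1 x y = \<bar>x 0 - y 0\<bar>"
        by (simp add: eucl_dist_def L2_set_def)
      have pos: "0 < eucl_dist 1 x y" and le: "eucl_dist 1 x y \<le> 2 * h"
        unfolding d using B y by auto
      have "(2 * h) powr (- (1 + s)) \<le> eucl_dist 1 x y powr (- (1 + s))"
        using pos le \<open>0 < s\<close> by (intro powr_mono2') auto
      also have "\<dots> = 1 / eucl_dist 1 x y powr (real 1 + s)"
        unfolding powr_minus_divide by simp
      finally have "ennreal ((2 * h) powr (- (1 + s)))
          \<le> ennreal (1 / eucl_dist 1 x y powr (real 1 + s))"
        by (rule ennreal_leI)
      also have "\<dots> = 1 / ennreal (eucl_dist 1 x y powr (real 1 + s))"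
        using pos by (simp add: divide_ennreal[symmetric])
      finally show "ennreal ((2 * h) powr (- (1 + s)))
          \<le> 1 / ennreal (eucl_dist 1 x y powr (real 1 + s))" .
    qed
    finally show "ennreal ((2 * h) powr (- s) / 2)
        \<le> (\<integral>\<^sup>+y\<in>Y. 1 / ennreal (eucl_dist 1 x y powr (real 1 + s)) \<partial>eucl_lebesgue 1)" .
  qed
  then show ?thesis unfolding emeasure_lift1[OF A(1)] .
qed

section \<open>The dyadic comb\<close>

definition mesh :: "nat \<Rightarrow> real" where
  "mesh m = (1 / 2) ^ (m\<^sup>2 + m + 2)"

definition shell :: "nat \<Rightarrow> real set" where
  "shell m = {(1 / 2) ^ Suc m..<(1 / 2) ^ m}"

definition cell :: "nat \<Rightarrow> nat \<Rightarrow> real set" where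
  "cell m k = {real k * mesh m..<real (Suc k) * mesh m}"

definition comb_shell :: "nat \<Rightarrow> real set" where
  "comb_shell m = (\<Union>j\<in>{2 ^ m\<^sup>2..<2 * 2 ^ m\<^sup>2}. cell m (2 * j))"

definition comb :: "real set" where
  "comb = (\<Union>m. comb_shell m)"

lemma mesh_pos: "0 < mesh m"
  by (simp add: mesh_def)

text \<open>The endpoints of \<open>shell m\<close> are thus multiples of \<open>mesh m\<close>,
  with factors \<open>2 * 2 ^ m\<^sup>2\<close> and \<open>4 * 2 ^ m\<^sup>2\<close>. The exponent
  in \<open>mesh\<close> is \<open>m + 1\<close> for the length of the shell plus
  \<open>m\<^sup>2 + 1\<close> for its division into \<open>2 * 2 ^ m\<^sup>2\<close> cells.\<close>

lemma mesh_times: "2 * 2 ^ m\<^sup>2 * mesh m = (1 / 2) ^ Suc m"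
  by (simp add: mesh_def power_add power_divide)

lemma cell_sets: "cell m k \<in> sets borel"
  by (simp add: cell_def)

lemma emeasure_cell: "emeasure lborel (cell m k) = ennreal (mesh m)"
  using mesh_pos[of m] by (simp add: cell_def algebra_simps)

lemma cell_subset_shell:
  assumes "2 * 2 ^ m\<^sup>2 \<le> k" "k < 4 * 2 ^ m\<^sup>2"
  shows "cell m k \<subseteq> shell m"
proof -
  have "real (2 * 2 ^ m\<^sup>2) \<le> real k" "real (Suc k) \<le> real (4 * 2 ^ m\<^sup>2)"
    using assms by (simp_all only: of_nat_le_iff Suc_le_eq)
  then have "real (2 * 2 ^ m\<^sup>2) * mesh m \<le> real k * mesh m"
    "real (Suc k) * mesh m \<le> real (4 * 2 ^ m\<^sup>2) * mesh m"
    using mesh_pos[of m] by (auto intro!: mult_right_mono)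
  moreover have "real (2 * 2 ^ m\<^sup>2) * mesh m = (1 / 2) ^ Suc m"
    "real (4 * 2 ^ m\<^sup>2) * mesh m = (1 / 2) ^ m"
    using mesh_times[of m] by simp_all
  ultimately show ?thesis
    unfolding cell_def shell_def by auto
qed

lemma shell_unique:
  assumes "x \<in> shell m" "x \<in> shell m'"
  shows "m = m'"
proof (rule ccontr)
  have *: False if "m < m'" "x \<in> shell m" "x \<in> shell m'" for m m'
  proof -
    have "(1 / 2 :: real) ^ m' \<le> (1 / 2) ^ Suc m"
      using that(1) by (intro power_decreasing) auto
    then show False using that by (simp add: shell_def)
  qed
  assume "m \<noteq> m'"
  then show False using * assms by (metis nat_neq_iff)
qed

lemma cell_unique:
  assumes "x \<in> cell m k" "x \<in> cell m k'"
  shows "k = k'"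
proof -
  have *: "k < Suc k'" if "x \<in> cell m k" "x \<in> cell m k'" for k k'
  proof -
    \<comment> \<open>The left end of one cell is at most \<open>x\<close>, which lies strictly
      below the right end of the other.\<close>
    have "real k * mesh m < real (Suc k') * mesh m"
      using that unfolding cell_def atLeastLessThan_iff by linarith
    then show ?thesis using mesh_pos[of m] by (simp del: of_nat_Suc)
  qed
  show ?thesis using *[OF assms] *[OF assms(2,1)] by simp
qed

lemma comb_shell_subset_shell: "comb_shell m \<subseteq> shell m"
  unfolding comb_shell_def by (intro UN_least cell_subset_shell) auto

lemma comb_shell_sets: "comb_shell m \<in> sets borel"
  unfolding comb_shell_def by (intro sets.finite_UN) (auto simp: cell_sets)

lemma comb_sets: "comb \<in> sets borel"
  unfolding comb_def using comb_shell_sets by auto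

text \<open>There are \<open>2 ^ m\<^sup>2\<close> disjoint cells of length \<open>mesh m\<close>,
  half of those in the shell.\<close>

lemma emeasure_comb_shell: "emeasure lborel (comb_shell m) = ennreal ((1 / 2) ^ (m + 2))"
proof -
  let ?J = "{2 ^ m\<^sup>2..<2 * 2 ^ m\<^sup>2} :: nat set"
  have "disjoint_family_on (\<lambda>j. cell m (2 * j)) ?J"
    unfolding disjoint_family_on_def using cell_unique by fastforce
  then have "emeasure lborel (comb_shell m) = (\<Sum>j\<in>?J. emeasure lborel (cell m (2 * j)))"
    unfolding comb_shell_def by (intro sum_emeasure[symmetric]) (auto simp: cell_sets)
  also have "\<dots> = ennreal (real (2 ^ m\<^sup>2) * mesh m)"
    using mesh_pos[of m] by (simp add: emeasure_cell ennreal_mult ennreal_of_nat_eq_real_of_nat)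
  also have "real (2 ^ m\<^sup>2) * mesh m = (1 / 2) ^ (m + 2)"
    using mesh_times[of m] by simp
  finally show ?thesis .
qed

text \<open>Shells are disjoint, so only \<open>comb_shell m\<close> could meet the cell, and its
  cells have even index.\<close>

lemma odd_cell_disjoint_comb:
  assumes "2 * 2 ^ m\<^sup>2 \<le> k" "k < 4 * 2 ^ m\<^sup>2" "odd k"
  shows "cell m k \<inter> comb = {}"
proof -
  have False if x: "x \<in> cell m k" "x \<in> comb_shell m'" for x m'
  proof -
    have "m' = m"
      using shell_unique x cell_subset_shell[OF assms(1,2)] comb_shell_subset_shell by blast
    with x obtain j where "x \<in> cell m (2 * j)"
      by (auto simp: comb_shell_def)
    then have "k = 2 * j" using cell_unique x by blast
    with \<open>odd k\<close> show False by simp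
  qed
  then show ?thesis by (auto simp: comb_def)
qed

section \<open>Divergence of the interaction inside the unit interval\<close>

abbreviation unit_interval :: "(nat \<Rightarrow> real) set" where
  "unit_interval \<equiv> {x \<in> eucl 1. 0 < x 0 \<and> x 0 < 1}"

lemma lift1_subset_inside:
  assumes "A \<subseteq> S" "A \<subseteq> {0<..<1}"
  shows "lift1 A \<subseteq> lift1 S \<inter> unit_interval"
proof
  fix x assume "x \<in> lift1 A"
  then have "x \<in> eucl 1" "x 0 \<in> S" "x 0 \<in> {0<..<1}"
    using assms unfolding lift1_eq by blast+
  then show "x \<in> lift1 S \<inter> unit_interval"
    unfolding lift1_eq greaterThanLessThan_iff by blast
qed

lemma lift1_subset_outside:
  assumes "A \<inter> S = {}" "A \<subseteq> {0<..<1}"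
  shows "lift1 A \<subseteq> (eucl 1 - lift1 S) \<inter> unit_interval"
proof
  fix x assume "x \<in> lift1 A"
  then have "x \<in> eucl 1" "x 0 \<notin> S" "x 0 \<in> {0<..<1}"
    using assms unfolding lift1_eq by blast+
  then show "x \<in> (eucl 1 - lift1 S) \<inter> unit_interval"
    unfolding lift1_eq greaterThanLessThan_iff by blast
qed

lemma shell_subset: "shell m \<subseteq> {0<..<1}"
proof
  fix x assume "x \<in> shell m"
  moreover have "(0::real) < (1 / 2) ^ Suc m" "(1 / 2 :: real) ^ m \<le> 1"
    by (auto intro: power_le_one)
  ultimately show "x \<in> {0<..<1}"
    unfolding shell_def atLeastLessThan_iff greaterThanLessThan_iff by linarith
qed

text \<open>In the exponent, the term with \<open>s\<close> comes from \<open>2 * mesh m\<close>,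
  while \<open>m + 3\<close> collects \<open>m + 2\<close> from the measure of
  \<open>comb_shell m\<close> and 1 from the factor \<open>1 / 2\<close> in
  \<open>interaction_ge\<close>.\<close>

lemma interaction_comb_ge:
  assumes "0 < s"
  shows "ennreal (2 powr (s * real (m\<^sup>2 + m + 1) - real m - 3))
    \<le> interaction 1 s (lift1 comb \<inter> unit_interval) ((eucl 1 - lift1 comb) \<inter> unit_interval)"
proof -
  have "ennreal ((2 * mesh m) powr (- s) / 2) * emeasure lborel (comb_shell m)
    \<le> interaction 1 s (lift1 comb \<inter> unit_interval) ((eucl 1 - lift1 comb) \<inter> unit_interval)"
  proof (rule interaction_ge)
    show "lift1 (comb_shell m) \<subseteq> lift1 comb \<inter> unit_interval"
    proof (rule lift1_subset_inside)
      show "comb_shell m \<subseteq> comb" by (auto simp: comb_def)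
      show "comb_shell m \<subseteq> {0<..<1}"
        using comb_shell_subset_shell shell_subset by blast
    qed
    fix x assume "x \<in> comb_shell m"
    then obtain j where j: "2 ^ m\<^sup>2 \<le> j" "j < 2 * 2 ^ m\<^sup>2" and x: "x \<in> cell m (2 * j)"
      by (auto simp: comb_shell_def)
    \<comment> \<open>The right neighbour of an even cell. It stays in the same shell because the
      shell ends at an even index.\<close>
    let ?B = "cell m (Suc (2 * j))"
    have k: "2 * 2 ^ m\<^sup>2 \<le> Suc (2 * j)" "Suc (2 * j) < 4 * 2 ^ m\<^sup>2" "odd (Suc (2 * j))"
      using j by simp_all
    have "lift1 ?B \<subseteq> (eucl 1 - lift1 comb) \<inter> unit_interval"
      by (rule lift1_subset_outside[OF odd_cell_disjoint_comb[OF k]])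
        (use cell_subset_shell[OF k(1,2)] shell_subset in blast)
    moreover have "x \<notin> ?B"
      using cell_unique[OF x, of "Suc (2 * j)"] by (metis n_not_Suc_n)
    moreover have "\<forall>y\<in>?B. \<bar>x - y\<bar> \<le> 2 * mesh m"
      using x by (auto simp: cell_def algebra_simps)
    ultimately show "\<exists>B\<in>sets borel. lift1 B \<subseteq> (eucl 1 - lift1 comb) \<inter> unit_interval \<and> x \<notin> B
        \<and> emeasure lborel B = ennreal (mesh m) \<and> (\<forall>y\<in>B. \<bar>x - y\<bar> \<le> 2 * mesh m)"
      by (intro bexI[of _ ?B] conjI) (auto simp only: cell_sets emeasure_cell)
  qed (use assms mesh_pos comb_shell_sets in auto)
  moreover have "(2 * mesh m) powr (- s) / 2 * (1 / 2) ^ (m + 2)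
      = 2 powr (s * real (m\<^sup>2 + m + 1) - real m - 3)"
  proof -
    have "2 * mesh m = 2 powr (- real (m\<^sup>2 + m + 1))"
      unfolding powr_minus powr_realpow[OF zero_less_numeral]
      by (simp add: mesh_def power_add field_simps)
    then have "(2 * mesh m) powr (- s) = 2 powr (s * real (m\<^sup>2 + m + 1))"
      by (simp only: powr_powr minus_mult_minus mult.commute)
    moreover have "(1 / 2 :: real) ^ (m + 2) / 2 = 2 powr (- real (m + 3))"
      unfolding powr_minus powr_realpow[OF zero_less_numeral]
      by (simp add: power_add field_simps)
    ultimately have "(2 * mesh m) powr (- s) / 2 * (1 / 2) ^ (m + 2)
        = 2 powr (s * real (m\<^sup>2 + m + 1)) * 2 powr (- real (m + 3))"
      by simp
    then show ?thesis
      by (simp add: powr_add[symmetric] algebra_simps)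
  qed
  ultimately show ?thesis
    by (simp add: emeasure_comb_shell ennreal_mult[symmetric])
qed

lemma interaction_comb:
  assumes "0 < s"
  shows "interaction 1 s (lift1 comb \<inter> unit_interval) ((eucl 1 - lift1 comb) \<inter> unit_interval)
    = \<infinity>" (is "?L = _")
proof (rule ccontr)
  assume "?L \<noteq> \<infinity>"
  then obtain r where r: "?L = ennreal r" "0 \<le> r"
    by (cases ?L) auto
  \<comment> \<open>The quadratic term \<open>s * m\<^sup>2\<close> outgrows \<open>m\<close> for
    every positive \<open>s\<close>, so one comb serves all \<open>s\<close>.\<close>
  have "filterlim (\<lambda>m. 2 powr (s * real (m\<^sup>2 + m + 1) - real m - 3)) at_top sequentially"
    using assms by real_asymp
  then have "\<forall>\<^sub>F m in sequentially. r < 2 powr (s * real (m\<^sup>2 + m + 1) - real m - 3)"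
    by (simp add: filterlim_at_top_dense)
  then obtain m where "r < 2 powr (s * real (m\<^sup>2 + m + 1) - real m - 3)"
    by (auto simp: eventually_sequentially)
  moreover have "ennreal (2 powr (s * real (m\<^sup>2 + m + 1) - real m - 3)) \<le> ennreal r"
    using interaction_comb_ge[OF assms, of m] r by simp
  ultimately show False using r by (simp add: ennreal_le_iff)
qed

theorem mainTheorem8:
  "\<exists>n\<ge>1. \<exists>\<Omega> E. \<exists>\<gamma>\<in>{0<..<1}.
     openin (eucl_top n) \<Omega> \<and> eucl_bounded n \<Omega> \<and> C1_holder_boundary n \<gamma> \<Omega> \<and>
     E \<in> sets (eucl_lebesgue n) \<and>
     (\<forall>s\<in>{0<..<1}. s_perimeter n s E \<Omega> = \<infinity>)"
\<comment> \<open>The witnesses stay schematic until the \<open>show\<close> commands fix them; they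
  are chosen before \<open>s\<close>.\<close>
proof (intro exI conjI bexI ballI)
  have "continuous_map (eucl_top 1) euclideanreal (\<lambda>x. x 0)"
    unfolding eucl_top_def by (rule continuous_map_product_projection) simp
  then have "openin (eucl_top 1) {x \<in> topspace (eucl_top 1). x 0 \<in> {0<..<1}}"
    by (rule openin_continuous_map_preimage) simp
  then show "openin (eucl_top 1) unit_interval"
    by (simp only: eucl_top_def topspace_product_topology topspace_euclidean
        greaterThanLessThan_iff)
  show "eucl_bounded 1 unit_interval"
    unfolding eucl_bounded_def
  proof (intro conjI exI ballI)
    show "unit_interval \<subseteq> eucl 1" by blast
    fix x assume "x \<in> unit_interval"
    then have "\<bar>x 0\<bar> \<le> 1" unfolding mem_Collect_eq by linarith
    then show "L2_set x {..<1} \<le> 1" by (simp add: L2_set_def)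
  qed
  \<comment> \<open>Any exponent in (0, 1) would do, since the boundary graphs are
    constants.\<close>
  show "C1_holder_boundary 1 (1 / 2) unit_interval"
    by (rule C1_holder_boundary_interval) simp
  show "lift1 comb \<in> sets (eucl_lebesgue 1)"
    by (rule lift1_sets[OF comb_sets])
  show "s_perimeter 1 s (lift1 comb) unit_interval = \<infinity>" if "s \<in> {0<..<1}" for s
  proof -
    have "0 < s" using that by simp
    then show ?thesis
      \<comment> \<open>The first of the three summands is already infinite.\<close>
      unfolding s_perimeter_def by (simp only: interaction_comb infinity_ennreal_def
        ennreal_add_eq_top simp_thms)
  qed
qed simp_all

end
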